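(* For every positive integer $k$, the graph $G_k$ satisfies $\kappa(G_k)=2k+2$.
   Context: Graphs are finite and simple. A graph $G$ is $\ell$-connected if $|V(G)|>\ell$ and deleting any set of at most $\ell-1$ vertices leaves the graph connected; the connectivity $\kappa(G)$ is the maximum $\ell$ such that $G$ is $\ell$-connected. The graph $G_k$: let $Q=\mathbb{F}_2^3$, with elements written as binary triples and addition coordinatewise modulo $2$. Put $P_0=\{100,010\}$, $P_1=\{001,110,101\}$, $P_2=\{011,111\}$; these form a partition of $Q\setminus\{000\}$. For a positive integer $k$, the vertex set of $G_k$ is $Q\times\{0,1,2\}\times\{1,\ldots,k\}$, where the vertex $(x,i,r)$ is written $x_i^{(r)}$. The edges are: (i) internal edges: for every $x\in Q$ and $r\in\{1,\ldots,k\}$, the vertices $x_0^{(r)},x_1^{(r)},x_2^{(r)}$ are pairwise adjacent; (ii) external edges: if $x,y\in Q$ are distinct, $r,s\in\{1,\ldots,k\}$, $i\in\{0,1,2\}$ and $x+y\in P_i$, then $x_i^{(r)}$ and $y_i^{(s)}$ are adjacent. There are no other edges. *)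

theory Defs
  imports "Graph_Theory.Graph_Theory" "HOL-Library.Z2" "HOL-Library.Product_Plus"
begin

text \<open>
  A finite simple graph is represented as a symmetric loop-free digraph with finitely many vertices
  and without parallel arcs (locales \<^locale>\<open>graph\<close> and \<^locale>\<open>pair_graph\<close>): an edge between
  \<open>u\<close> and \<open>v\<close> is the pair of arcs \<open>(u, v)\<close>, \<open>(v, u)\<close>. The two definitions below are meant for
  such graphs. ``At most \<open>l - 1\<close> vertices'' is written \<open>card S < l\<close>, so that nothing is required of
  \<open>S\<close> when \<open>l = 0\<close>.
\<close>

definition l_connected :: "nat \<Rightarrow> ('a, 'b) pre_digraph \<Rightarrow> bool" where
  "l_connected l G \<longleftrightarrow>
     card (verts G) > l \<and>
     (\<forall>S. S \<subseteq> verts G \<and> card S < l \<longrightarrow> Digraph_Component.connected (G \<restriction> (verts G - S)))"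

text \<open>
  For a finite nonempty graph the set below is finite and contains \<open>0\<close>, so the maximum exists.
\<close>

definition connectivity :: "('a, 'b) pre_digraph \<Rightarrow> nat" where
  "connectivity G = Max {l. l_connected l G}"

lemma finite_l_connected: "finite {l. l_connected l G}"
  by (rule finite_subset[of _ "{..<card (verts G)}"]) (auto simp: l_connected_def)

lemma l_connected_0: "finite (verts G) \<Longrightarrow> verts G \<noteq> {} \<Longrightarrow> l_connected 0 G"
  by (simp add: l_connected_def card_gt_0_iff)

text \<open>The type \<^typ>\<open>bit\<close> is the field with two elements; addition of triples is coordinatewise.\<close>

type_synonym Q = "bit \<times> bit \<times> bit"

definition P :: "nat \<Rightarrow> Q set" where
  "P i = (if i = 0 then {(1,0,0), (0,1,0)}
          else if i = 1 then {(0,0,1), (1,1,0), (1,0,1)}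
          else if i = 2 then {(0,1,1), (1,1,1)}
          else {})"

lemma P_partition:
  "(\<Union>i\<in>{0,1,2}. P i) = UNIV - {0}"
  "i \<noteq> j \<Longrightarrow> P i \<inter> P j = {}"
proof -
  show "(\<Union>i\<in>{0,1,2}. P i) = UNIV - {0}"
  proof (intro set_eqI)
    fix x :: Q
    obtain a b c where "x = (a, b, c)" by (cases x)
    then show "x \<in> (\<Union>i\<in>{0,1,2}. P i) \<longleftrightarrow> x \<in> UNIV - {0}"
      by (cases a; cases b; cases c) (simp_all add: P_def zero_prod_def)
  qed
  show "i \<noteq> j \<Longrightarrow> P i \<inter> P j = {}"
    by (auto simp: P_def split: if_splits)
qed

text \<open>The triple \<open>(x, i, r)\<close> is the vertex $x_i^{(r)}$.\<close>

definition Gk :: "nat \<Rightarrow> (Q \<times> nat \<times> nat) pair_pre_digraph" where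
  "Gk k =
     \<lparr> pverts = UNIV \<times> {0,1,2} \<times> {1..k},
       parcs =
         {((x, i, r), (x, j, r)) | x i j r.
            i \<in> {0,1,2} \<and> j \<in> {0,1,2} \<and> i \<noteq> j \<and> r \<in> {1..k}} \<union>
         {((x, i, r), (y, i, s)) | x y i r s.
            x \<noteq> y \<and> i \<in> {0,1,2} \<and> r \<in> {1..k} \<and> s \<in> {1..k} \<and> x + y \<in> P i} \<rparr>"

lemma finite_UNIV_Q: "finite (UNIV :: Q set)"
proof -
  have "(UNIV :: bit set) = {0, 1}"
  proof (intro set_eqI)
    fix x :: bit
    show "x \<in> UNIV \<longleftrightarrow> x \<in> {0, 1}"
      by (cases x) simp_all
  qed
  then have "finite (UNIV :: bit set)"
    by (metis finite.emptyI finite_insert)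
  then show ?thesis
    by (simp add: finite_prod)
qed

lemma pair_graph_Gk: "pair_graph (Gk k)"
proof -
  have fin: "finite (pverts (Gk k))"
    using finite_UNIV_Q by (simp add: Gk_def)
  have sub: "parcs (Gk k) \<subseteq> pverts (Gk k) \<times> pverts (Gk k)"
    unfolding Gk_def pair_pre_digraph.simps by blast
  have sym: "(v, u) \<in> parcs (Gk k)" if "(u, v) \<in> parcs (Gk k)" for u v
    using that unfolding Gk_def pair_pre_digraph.simps Un_iff mem_Collect_eq prod.inject
    by (metis add.commute)
  have noloop: "u \<noteq> v" if "(u, v) \<in> parcs (Gk k)" for u v
    using that unfolding Gk_def pair_pre_digraph.simps by blast
  have ends: "fst e \<in> pverts (Gk k) \<and> snd e \<in> pverts (Gk k)" if "e \<in> parcs (Gk k)" for e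
    using subsetD[OF sub that] unfolding mem_Times_iff .
  show ?thesis
  proof
    show "fst e \<in> pverts (Gk k)" if "e \<in> parcs (Gk k)" for e
      using ends[OF that] by (rule conjunct1)
    show "snd e \<in> pverts (Gk k)" if "e \<in> parcs (Gk k)" for e
      using ends[OF that] by (rule conjunct2)
    show "fst e \<noteq> snd e" if "e \<in> parcs (Gk k)" for e
      by (rule noloop) (simp only: prod.collapse that)
    show "finite (pverts (Gk k))"
      by (rule fin)
    show "finite (parcs (Gk k))"
      by (rule finite_subset[OF sub finite_cartesian_product[OF fin fin]])
    show "symmetric (with_proj (Gk k))"
      unfolding symmetric_def with_proj_simps by (rule symI) (rule sym)
  qed
qed

end

theory Submission
  imports Defs
begin

text \<open>
  The upper bound is a degree count: the vertex \<open>000\<^sub>0\<close> has two internal and \<open>2 * k\<close> external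
  neighbours, and deleting them isolates it (\<open>l_connected_Gk_le\<close>).

  For the lower bound, let \<open>S\<close> be a set of at most \<open>2 * k + 1\<close> vertices. Connectedness of what is left
  is treated as the statement that every vertex colouring that is constant along edges is constant
  (\<open>connected_induced_iff_colouring\<close>). The decisive observation is the shape of the layers, that is,
  of the subgraphs on the vertices with a fixed middle index. Since \<open>P 0\<close> and \<open>P 2\<close> have two
  elements each, the layers \<open>0\<close> and \<open>2\<close> are each the disjoint union of two complete bipartite
  graphs with sides of size \<open>2 * k\<close> (\<open>add_in_P_iff\<close>, \<open>card_side\<close>); layer \<open>1\<close> is a cube with every
  vertex replaced by \<open>k\<close> independent copies. There are two cases.

  If no side of these four bipartite graphs lies inside \<open>S\<close>, each of them stays connected
  (\<open>constant_if_sides_survive\<close>). Each bipartite graph of layer \<open>0\<close> is joined to each one of layer \<open>2\<close>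
  through \<open>2 * k\<close> internal triangles, and different pairs use different triangles; as
  \<open>4 * k > card S\<close>, at most one of the four pairs is separated, so the layers \<open>0\<close> and \<open>2\<close>
  together stay connected. A surviving vertex of layer \<open>1\<close> that is cut off from them would cost two
  deletions in its own triangle and one in each of the \<open>3 * k\<close> triangles of its neighbours.

  If some side lies inside \<open>S\<close>, at most one vertex outside it is deleted
  (\<open>constant_if_side_deleted\<close>). Layer \<open>1\<close> loses at most one vertex and stays connected, and all
  other vertices reach it, going through the other two layers if the missing vertex is in the way.
\<close>

section \<open>Connectedness through two-colourings\<close>

text \<open>
  For the direction from colourings to connectedness the colour of a vertex is whether it can be
  reached from a fixed one. Colourings turn later arguments about paths into equations.
\<close>

lemma connected_induced_iff_colouring:
  fixes G :: "'a pair_pre_digraph"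
  shows "Digraph_Component.connected (with_proj G \<restriction> U) \<longleftrightarrow>
    U \<noteq> {} \<and> (\<forall>c :: 'a \<Rightarrow> bool. (\<forall>u\<in>U. \<forall>v\<in>U. (u, v) \<in> parcs G \<longrightarrow> c u = c v) \<longrightarrow>
      (\<forall>u\<in>U. \<forall>v\<in>U. c u = c v))"
    (is "?con \<longleftrightarrow> U \<noteq> {} \<and> (\<forall>c. ?good c \<longrightarrow> ?const c)")
proof -
  let ?H = "mk_symmetric (with_proj G \<restriction> U)"
  have verts: "pverts ?H = U"
    by simp
  have arcs: "parcs ?H = {(u, v). u \<in> U \<and> v \<in> U \<and> ((u, v) \<in> parcs G \<or> (v, u) \<in> parcs G)}"
    by (auto simp: parcs_mk_symmetric)
  have con: "?con \<longleftrightarrow> U \<noteq> {} \<and> (\<forall>u\<in>U. \<forall>v\<in>U. u \<rightarrow>\<^sup>*\<^bsub>?H\<^esub> v)"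
    unfolding Digraph_Component.connected_def strongly_connected_def with_proj_simps verts ..
  have to_const: "?const c" if reach: "\<forall>u\<in>U. \<forall>v\<in>U. u \<rightarrow>\<^sup>*\<^bsub>?H\<^esub> v" and good: "?good c" for c
  proof (intro ballI)
    fix u v assume "u \<in> U" "v \<in> U"
    then have "(u, v) \<in> rtrancl_on U (parcs ?H)"
      using reach by (auto simp: reachable_def)
    then show "c u = c v"
      by (induction rule: rtrancl_on_induct) (use good arcs in blast)+
  qed
  have to_reach: "u \<rightarrow>\<^sup>*\<^bsub>?H\<^esub> v"
    if const: "\<forall>c. ?good c \<longrightarrow> ?const c" and uv: "u \<in> U" "v \<in> U" for u v
  proof -
    let ?c = "\<lambda>w. (u, w) \<in> rtrancl_on U (parcs ?H)"
    have step: "?c y" if "?c x" "(x, y) \<in> parcs ?H" for x y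
      by (rule rtrancl_on_into_rtrancl_on[OF that]) (use that(2) arcs in simp)
    have "?good ?c"
    proof (intro ballI impI)
      fix x y assume "x \<in> U" "y \<in> U" "(x, y) \<in> parcs G"
      then have "(x, y) \<in> parcs ?H" "(y, x) \<in> parcs ?H"
        unfolding arcs by simp_all
      then show "?c x = ?c y"
        using step by metis
    qed
    then have "?const ?c"
      by (rule const[THEN spec, THEN mp])
    then have "?c u = ?c v"
      using uv by (meson bspec)
    with uv show ?thesis
      by (auto simp: reachable_def)
  qed
  show ?thesis
    unfolding con
  proof (intro conj_cong refl iffI allI impI)
    show "?const c" if "\<forall>u\<in>U. \<forall>v\<in>U. u \<rightarrow>\<^sup>*\<^bsub>?H\<^esub> v" "?good c" for c
      by (rule to_const[OF that])
    show "\<forall>u\<in>U. \<forall>v\<in>U. u \<rightarrow>\<^sup>*\<^bsub>?H\<^esub> v" if "\<forall>c. ?good c \<longrightarrow> ?const c"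
      by (intro ballI to_reach[OF that])
  qed
qed

section \<open>The layers of the graph\<close>

lemma all_bit: "(\<forall>b :: bit. R b) \<longleftrightarrow> R 0 \<and> R 1"
  by (metis bit.exhaust)

text \<open>
  For \<open>i \<in> {0, 2}\<close>, \<open>piece i x\<close> names the coset of the span of \<open>P i\<close> that contains \<open>x\<close>,
  hence a bipartite component of layer \<open>i\<close>, and \<open>side i x\<close> names the colour class of \<open>x\<close> in that
  component. The map \<open>piece 2\<close> is also the
  proper two-colouring of the cube that underlies layer \<open>1\<close>, because it is \<open>1\<close> on \<open>P 1\<close>.
\<close>

definition piece :: "nat \<Rightarrow> Q \<Rightarrow> bit" where
  "piece i x = (case x of (x1, x2, x3) \<Rightarrow> if i = 0 then x3 else x2 + x3)"

definition side :: "nat \<Rightarrow> Q \<Rightarrow> bit" where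
  "side i x = (case x of (x1, x2, x3) \<Rightarrow> if i = 0 then x1 + x2 else x3)"

text \<open>
  The linear maps \<open>piece i\<close> and \<open>side i\<close> are chosen so that \<open>P i\<close> is the set of vectors on which
  they take the values \<open>0\<close> and \<open>1\<close>; hence the layers \<open>0\<close> and \<open>2\<close> are disjoint unions of
  complete bipartite graphs.
\<close>

lemma add_in_P_iff:
  assumes "i \<in> {0, 2}"
  shows "x + y \<in> P i \<longleftrightarrow> piece i x = piece i y \<and> side i x \<noteq> side i y"
proof -
  obtain x1 x2 x3 y1 y2 y3 where [simp]: "x = (x1, x2, x3)" "y = (y1, y2, y3)"
    by (metis prod_cases3)
  have "(\<forall>x1 x2 x3 y1 y2 y3 :: bit.
      ((x1, x2, x3) + (y1, y2, y3) \<in> P i \<longleftrightarrow>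
       piece i (x1, x2, x3) = piece i (y1, y2, y3) \<and> side i (x1, x2, x3) \<noteq> side i (y1, y2, y3)))"
  proof (cases "i = 0")
    case True
    then show ?thesis
      unfolding all_bit by (simp add: P_def piece_def side_def del: add_bit_eq_xor)
  next
    case False
    with assms have "i = 2"
      by simp
    then show ?thesis
      unfolding all_bit by (simp add: P_def piece_def side_def del: add_bit_eq_xor)
  qed
  then show ?thesis
    by simp
qed

lemma card_side:
  assumes "i \<in> {0, 2}"
  shows "card {x. piece i x = a \<and> side i x = b} = 2"
proof -
  have "{x. piece i x = a \<and> side i x = b} =
      (if i = 0 then {(0, b, a), (1, b + 1, a)} else {(0, a + b, b), (1, a + b, b)})"
    using assms unfolding set_eq_iff split_paired_All all_bit
    by (cases a; cases b) (auto simp: piece_def side_def)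
  then show ?thesis
    by simp
qed

lemma card_piece_Int: "card {x. piece 0 x = a \<and> piece 2 x = b} = 2"
proof -
  have "{x. piece 0 x = a \<and> piece 2 x = b} = {(0, a + b, a), (1, a + b, a)}"
    unfolding set_eq_iff split_paired_All all_bit
    by (cases a; cases b) (auto simp: piece_def)
  then show ?thesis
    by simp
qed

text \<open>
  This provides two common neighbours, \<open>x + p\<close> and \<open>x + q\<close>, for vertices \<open>x\<close> and \<open>x + d\<close> on the
  same side of the cube. A nonzero \<open>d\<close> with \<open>piece 2 d = 0\<close> is the sum of two elements of
  \<open>P 1\<close>, and these serve as \<open>p\<close> and \<open>q\<close>; for \<open>d = 0\<close> any two elements do.
\<close>

lemma two_sums_in_P_1:
  assumes "piece 2 d = 0"
  obtains p q where "p \<in> P 1" "q \<in> P 1" "p \<noteq> q" "p + d \<in> P 1" "q + d \<in> P 1"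
proof -
  obtain d1 d2 d3 where d: "d = (d1, d2, d3)"
    by (rule prod_cases3)
  with assms have "d3 = d2"
    by (cases d2; cases d3) (simp_all add: piece_def)
  then consider "d \<in> {(0, 0, 0), (1, 1, 1)}" | "d = (1, 0, 0)" | "d = (0, 1, 1)"
    unfolding d by (cases d1; cases d2) simp_all
  then show ?thesis
  proof cases
    case 1
    then show ?thesis
      by (intro that[of "(0, 0, 1)" "(1, 1, 0)"]) (auto simp: P_def zero_prod_def)
  next
    case 2
    then show ?thesis
      by (intro that[of "(0, 0, 1)" "(1, 0, 1)"]) (auto simp: P_def)
  next
    case 3
    then show ?thesis
      by (intro that[of "(1, 1, 0)" "(1, 0, 1)"]) (auto simp: P_def)
  qed
qed

lemma piece_add: "piece i (x + y) = piece i x + piece i y"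
  by (cases x; cases y) (simp add: piece_def algebra_simps del: add_bit_eq_xor)

lemma piece_2_add_P_1: "p \<in> P 1 \<Longrightarrow> piece 2 (x + p) = piece 2 x + 1"
  by (cases x) (auto simp: P_def piece_def simp del: add_bit_eq_xor)

lemma add_self_Q [simp]: "x + x = (0 :: Q)" "x + (x + y) = (y :: Q)"
proof -
  have "b + b = 0" for b :: bit
    by (cases b) simp_all
  then show "x + x = 0"
    by (cases x) (simp add: zero_prod_def)
  then show "x + (x + y) = y"
    by (metis add.assoc add_0)
qed

lemma arc_Gk_iff:
  "((x, i, r), (y, j, s)) \<in> parcs (Gk k) \<longleftrightarrow>
     i \<in> {0, 1, 2} \<and> j \<in> {0, 1, 2} \<and> r \<in> {1..k} \<and> s \<in> {1..k} \<and>
     (x = y \<and> r = s \<and> i \<noteq> j \<or> x \<noteq> y \<and> i = j \<and> x + y \<in> P i)"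
  unfolding Gk_def pair_pre_digraph.simps Un_iff mem_Collect_eq prod.inject
  by (auto simp del: split_paired_Ex)

section \<open>Colourings of what a small vertex set leaves over\<close>

text \<open>
  This is how deletions are counted: triangles are disjoint, so a set that meets all triangles
  over \<open>A\<close> is at least as large as their number.
\<close>

lemma card_mult_le_hit:
  assumes "finite S"
    and "\<And>x r. x \<in> A \<Longrightarrow> r \<in> {1..k} \<Longrightarrow> \<exists>i. (x, i, r) \<in> S"
  shows "card A * k \<le> card (S :: (Q \<times> nat \<times> nat) set)"
proof -
  have "A \<times> {1..k} \<subseteq> (\<lambda>(x, i, r). (x, r)) ` S"
    using assms(2) by force
  then have "card (A \<times> {1..k}) \<le> card ((\<lambda>(x, i, r). (x, r)) ` S)"
    using assms(1) by (intro card_mono) auto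
  also have "\<dots> \<le> card S"
    by (rule card_image_le[OF assms(1)])
  finally show ?thesis
    by (simp add: card_cartesian_product)
qed

locale colouring_off =
  fixes k :: nat and S :: "(Q \<times> nat \<times> nat) set" and c :: "Q \<times> nat \<times> nat \<Rightarrow> 'c"
  assumes k_pos: "k > 0" and finite_S: "finite S" and card_S: "card S \<le> 2 * k + 1"
    and colour_arc: "\<And>u v. (u, v) \<in> parcs (Gk k) \<Longrightarrow> u \<notin> S \<Longrightarrow> v \<notin> S \<Longrightarrow> c u = c v"
begin

text \<open>The bound on \<open>r\<close> is included so that survivors are vertices as soon as their layer is valid.\<close>

definition alive :: "Q \<Rightarrow> nat \<Rightarrow> nat \<Rightarrow> bool" where
  "alive x i r \<longleftrightarrow> r \<in> {1..k} \<and> (x, i, r) \<notin> S"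

lemma colour_internal:
  assumes "alive x i r" "alive x j r" "i \<in> {0, 1, 2}" "j \<in> {0, 1, 2}"
  shows "c (x, i, r) = c (x, j, r)"
proof (cases "i = j")
  case False
  with assms show ?thesis
    by (intro colour_arc) (auto simp only: arc_Gk_iff alive_def)
qed simp

lemma colour_external:
  assumes "alive x i r" "alive y i s" "x + y \<in> P i"
  shows "c (x, i, r) = c (y, i, s)"
proof -
  have "i \<in> {0, 1, 2}"
    using assms(3) by (auto simp: P_def split: if_splits)
  moreover have "x \<noteq> y"
    using assms(3) by (auto simp: P_def zero_prod_def split: if_splits)
  ultimately show ?thesis
    using assms
    by (intro colour_arc) (auto simp only: arc_Gk_iff alive_def)
qed

text \<open>
  Two survivors on the same side of a bipartite component are both adjacent to a survivor on the
  opposite side, so each component is monochromatic. The four components form a cycle in which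
  consecutive ones share \<open>2 * k\<close> triangles; since fewer than \<open>4 * k\<close> vertices are deleted, at
  least three of the four links of the cycle survive.
\<close>

lemma constant_if_sides_survive:
  assumes survive: "\<And>i a b. i \<in> {0, 2} \<Longrightarrow> \<exists>x r. piece i x = a \<and> side i x = b \<and> alive x i r"
  shows "\<exists>t. \<forall>x r. \<forall>i\<in>{0, 1, 2}. alive x i r \<longrightarrow> c (x, i, r) = t"
proof -
  have same_piece: "c (x, i, r) = c (y, i, s)"
    if i: "i \<in> {0, 2}" and alive: "alive x i r" "alive y i s" and piece: "piece i x = piece i y"
    for i x y r s
  proof (cases "side i x = side i y")
    case True
    obtain z q where z: "piece i z = piece i x" "side i z = side i x + 1" "alive z i q"
      using survive[OF i] by blast
    have "side i x \<noteq> side i x + 1"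
      by simp
    then have "x + z \<in> P i" "y + z \<in> P i"
      using z piece True by (simp_all only: add_in_P_iff[OF i]) simp_all
    then have "c (x, i, r) = c (z, i, q)" "c (y, i, s) = c (z, i, q)"
      using colour_external alive z(3) by blast+
    then show ?thesis
      by simp
  next
    case False
    then show ?thesis
      using alive piece by (intro colour_external) (simp_all add: add_in_P_iff[OF i])
  qed
  have "\<exists>t. \<forall>x r. piece i x = a \<and> alive x i r \<longrightarrow> c (x, i, r) = t" if i: "i \<in> {0, 2}" for i a
  proof -
    obtain y s where "piece i y = a" "alive y i s"
      using survive[OF i] by blast
    then show ?thesis
      using same_piece[OF i] by metis
  qed
  then obtain f where f: "\<And>i x r. i \<in> {0, 2} \<Longrightarrow> alive x i r \<Longrightarrow> c (x, i, r) = f i (piece i x)"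
    by metis
  have link: "f 0 a = f 2 b \<or> f 0 a' = f 2 b'" if ne: "(a, b) \<noteq> (a', b')" for a b a' b'
  proof (rule ccontr)
    assume no: "\<not> ?thesis"
    \<comment> \<open>Two broken links would have all their \<open>4 * k\<close> triangles hit.\<close>
    let ?A = "{x. piece 0 x = a \<and> piece 2 x = b}" and ?B = "{x. piece 0 x = a' \<and> piece 2 x = b'}"
    have "card (?A \<union> ?B) = card ?A + card ?B"
      using ne by (intro card_Un_disjoint finite_subset[OF subset_UNIV finite_UNIV_Q]) auto
    then have "card (?A \<union> ?B) = 4"
      by (simp add: card_piece_Int)
    moreover have "\<exists>i. (x, i, r) \<in> S" if x: "x \<in> ?A \<union> ?B" and r: "r \<in> {1..k}" for x r
    proof (rule ccontr)
      assume "\<not> ?thesis"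
      with r have "alive x 0 r" "alive x 2 r"
        by (auto simp: alive_def)
      then have "f 0 (piece 0 x) = f 2 (piece 2 x)"
        using f colour_internal[of x 0 r 2] by simp
      with x no show False
        by auto
    qed
    ultimately have "4 * k \<le> card S"
      using card_mult_le_hit[OF finite_S, of "?A \<union> ?B" k] by simp
    with card_S k_pos show False
      by simp
  qed
  have f_const: "f i a = f 0 0" if "i \<in> {0, 2}" for i a
    using that link[of 0 0 0 1] link[of 0 0 1 0] link[of 0 0 1 1] link[of 0 1 1 0]
      link[of 0 1 1 1] link[of 1 0 1 1]
    by (cases a) auto
  have even_layer: "c (x, i, r) = f 0 0" if "i \<in> {0, 2}" "alive x i r" for x i r
    using f[OF that] f_const[OF that(1)] by simp
  have layer_1: "c (x, 1, r) = f 0 0" if alive: "alive x 1 r" for x r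
  proof (cases "alive x 0 r \<or> alive x 2 r")
    case True
    then show ?thesis
      using colour_internal[OF alive] even_layer by (metis insertCI)
  next
    case False
    \<comment> \<open>The two deletions in the triangle of \<open>x\<close> leave fewer than \<open>3 * k\<close> for those of its
      neighbours in layer \<open>1\<close>, so some neighbouring triangle is untouched.\<close>
    let ?S = "S - {(x, 0, r), (x, 2, r)}"
    have dead: "{(x, 0, r), (x, 2, r)} \<subseteq> S"
      using False alive by (auto simp: alive_def)
    have "card ?S = card S - 2"
      using dead by (simp add: card_Diff_subset)
    moreover have "card S \<ge> 2"
      using card_mono[OF finite_S dead] by simp
    ultimately have "card ?S < 3 * k"
      using card_S k_pos by linarith
    moreover have "card ((+) x ` P 1) = 3"
      by (subst card_image) (auto simp: inj_on_def P_def)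
    ultimately have "\<not> card ((+) x ` P 1) * k \<le> card ?S"
      by simp
    then have "\<not> (\<forall>y\<in>(+) x ` P 1. \<forall>s\<in>{1..k}. \<exists>i. (y, i, s) \<in> ?S)"
      using card_mult_le_hit[OF finite_Diff[OF finite_S]] by meson
    then obtain p s where p: "p \<in> P 1" and s: "s \<in> {1..k}" and out: "\<And>i. (x + p, i, s) \<notin> ?S"
      by blast
    have "x + p \<noteq> x"
      using p by (auto simp: P_def zero_prod_def)
    with s out have y: "alive (x + p) i s" for i
      by (auto simp: alive_def)
    have "c (x, 1, r) = c (x + p, 1, s)"
      using alive y p by (intro colour_external) auto
    also have "\<dots> = c (x + p, 0, s)"
      by (intro colour_internal y) auto
    also have "\<dots> = f 0 0"
      by (intro even_layer y) auto
    finally show ?thesis .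
  qed
  show ?thesis
    using even_layer layer_1 by (metis empty_iff insert_iff)
qed

text \<open>
  A deleted side uses up \<open>2 * k\<close> of the deletions, so at most one vertex \<open>v\<close> is missing elsewhere.
  Layer \<open>1\<close> minus \<open>v\<close> is connected: vertices on the same side of the cube have two common
  neighbours, one of which survives, and there are two disjoint edges between the sides, one of
  which survives. The remaining vertices are attached through their triangle, except in the
  triangle of \<open>v\<close>, where the undamaged layer \<open>j\<close> provides a detour.
\<close>

lemma constant_if_side_deleted:
  assumes i: "i \<in> {0, 2}"
    and deleted: "\<And>x r. piece i x = a \<Longrightarrow> side i x = b \<Longrightarrow> \<not> alive x i r"
  shows "\<exists>t. \<forall>x r. \<forall>i\<in>{0, 1, 2}. alive x i r \<longrightarrow> c (x, i, r) = t"
proof -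
  let ?T = "{x. piece i x = a \<and> side i x = b} \<times> {i} \<times> {1..k}"
  have "?T \<subseteq> S"
    using deleted by (auto simp: alive_def)
  moreover have "card ?T = 2 * k"
    by (simp add: card_cartesian_product card_side[OF i])
  ultimately have "card (S - ?T) \<le> Suc 0"
    using card_S card_Diff_subset[OF finite_subset[OF _ finite_S]] by fastforce
  then have "\<forall>u\<in>S - ?T. \<forall>v\<in>S - ?T. u = v"
    using finite_S card_le_Suc0_iff_eq[of "S - ?T"] by blast
  then obtain v where "S - ?T \<subseteq> {v}"
    by blast
  then have S: "(x, j, r) \<notin> S" if "j \<noteq> i" "(x, j, r) \<noteq> v" for x j r
    using that by blast
  have same_side: "c (x, 1, r) = c (y, 1, s)"
    if alive: "alive x 1 r" "alive y 1 s" and piece: "piece 2 x = piece 2 y" for x y r s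
  proof -
    have "piece 2 (x + y) = 0"
      using piece by (simp add: piece_add)
    then obtain p q where pq: "p \<in> P 1" "q \<in> P 1" "p \<noteq> q"
        "p + (x + y) \<in> P 1" "q + (x + y) \<in> P 1"
      by (rule two_sums_in_P_1)
    have "(x + p, 1, 1) \<noteq> v \<or> (x + q, 1, 1) \<noteq> v"
      using pq(3) by auto
    then obtain z where z: "z + (x + y) \<in> P 1" "z \<in> P 1" "(x + z, 1, 1) \<noteq> v"
      using pq by blast
    have in_P: "x + (x + z) \<in> P 1" "x + z + y \<in> P 1"
      using z by (simp_all add: add.commute add.left_commute)
    have mid: "alive (x + z) 1 1"
      using S[OF _ z(3)] k_pos i by (auto simp: alive_def)
    have "c (x, 1, r) = c (x + z, 1, 1)" "c (x + z, 1, 1) = c (y, 1, s)"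
      by (rule colour_external[OF alive(1) mid in_P(1)])
        (rule colour_external[OF mid alive(2) in_P(2)])
    then show ?thesis
      by simp
  qed
  have "\<exists>t. \<forall>x r. alive x 1 r \<longrightarrow> c (x, 1, r) = t"
  proof -
    obtain p x y :: Q where p: "p \<in> P 1" and ne: "x \<noteq> y" "x \<noteq> y + p" "x + p \<noteq> y" "x + p \<noteq> y + p"
      by (rule that[of "(0, 0, 1)" "(0, 0, 0)" "(1, 0, 0)"]) (simp_all add: P_def)
    have "(x, 1, 1) \<noteq> v \<and> (x + p, 1, 1) \<noteq> v \<or> (y, 1, 1) \<noteq> v \<and> (y + p, 1, 1) \<noteq> v"
      using ne by (metis prod.inject)
    with p have "\<exists>x p. p \<in> P 1 \<and> (x, 1, 1) \<noteq> v \<and> (x + p, 1, 1) \<noteq> v"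
      by blast
    then obtain x p where p: "p \<in> P 1" "(x, 1, 1) \<noteq> v" "(x + p, 1, 1) \<noteq> v"
      by blast
    then have alive: "alive x 1 1" "alive (x + p) 1 1"
      using S[OF _ p(2)] S[OF _ p(3)] i k_pos by (auto simp: alive_def)
    have "c (x + p, 1, 1) = c (x, 1, 1)"
      using alive p by (intro colour_external[symmetric]) auto
    moreover have "piece 2 y = piece 2 x \<or> piece 2 y = piece 2 (x + p)" for y
      by (cases "piece 2 y"; cases "piece 2 x") (simp_all add: piece_2_add_P_1[OF p(1)])
    ultimately have "c (y, 1, r) = c (x, 1, 1)" if "alive y 1 r" for y r
      using same_side[OF that] alive by metis
    then show ?thesis
      by blast
  qed
  then obtain t where layer_1: "\<And>x r. alive x 1 r \<Longrightarrow> c (x, 1, r) = t"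
    by blast
  have "1 \<noteq> i"
    using i by auto
  define j where "j = 2 - i"
  have j: "j \<in> {0, 2}" "j \<noteq> i"
    using i by (auto simp: j_def)
  have layer_j: "c (x, j, r) = t" if alive: "alive x j r" for x r
  proof (cases "alive x 1 r")
    case True
    then show ?thesis
      using colour_internal[OF alive True] layer_1 j by auto
  next
    case False
    then have v: "v = (x, 1, r)"
      using S[OF \<open>1 \<noteq> i\<close>] alive by (metis alive_def)
    have "P j \<noteq> {}"
      using j by (auto simp: P_def)
    then obtain p where p: "p \<in> P j"
      by blast
    have "x + p \<noteq> x"
      using p j by (auto simp: P_def zero_prod_def)
    then have y: "alive (x + p) j r" "alive (x + p) 1 r"
      using S[of j "x + p" r] S[of 1 "x + p" r] v i j alive by (auto simp: alive_def)
    have "c (x, j, r) = c (x + p, j, r)"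
      using alive y(1) p by (intro colour_external) auto
    also have "\<dots> = c (x + p, 1, r)"
      using y j by (intro colour_internal) auto
    finally show ?thesis
      using layer_1[OF y(2)] by simp
  qed
  have layer_i: "c (x, i, r) = t" if alive: "alive x i r" for x r
  proof (cases "alive x 1 r")
    case True
    then show ?thesis
      using colour_internal[OF alive True] layer_1 i by auto
  next
    case False
    then have "v = (x, 1, r)"
      using S[OF \<open>1 \<noteq> i\<close>] alive by (metis alive_def)
    then have "alive x j r"
      using S[of j x r] j alive by (auto simp: alive_def)
    then show ?thesis
      using colour_internal[OF alive, of j] layer_j[of x r] i j by auto
  qed
  have "c (x, l, r) = t" if l: "l \<in> {0, 1, 2}" and alive: "alive x l r" for x l r
  proof -
    consider "l = 1" | "l = i" | "l = j"
      using l i by (auto simp: j_def)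
    then show ?thesis
      using alive layer_1[of x r] layer_i[of x r] layer_j[of x r] by cases simp_all
  qed
  then show ?thesis
    by (intro exI[of _ t] allI ballI impI)
qed

lemma colouring_constant: "\<exists>t. \<forall>x r. \<forall>i\<in>{0, 1, 2}. alive x i r \<longrightarrow> c (x, i, r) = t"
proof (cases "\<forall>i\<in>{0, 2}. \<forall>a b. \<exists>x r. piece i x = a \<and> side i x = b \<and> alive x i r")
  case True
  show ?thesis
    by (rule constant_if_sides_survive) (rule True[THEN bspec, THEN spec, THEN spec])
next
  case False
  then obtain i a b where i: "i \<in> {0, 2}"
    and none: "\<not> (\<exists>x r. piece i x = a \<and> side i x = b \<and> alive x i r)"
    unfolding Ball_def not_all not_imp by (elim exE conjE) (rule that)
  have "\<not> alive x i r" if "piece i x = a" "side i x = b" for x r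
    using none that by metis
  then show ?thesis
    by (rule constant_if_side_deleted[OF i])
qed

end

section \<open>The two bounds\<close>

lemma card_verts_Gk: "card (pverts (Gk k)) = 24 * k"
proof -
  have bit: "UNIV = {0, 1 :: bit}"
    using bit_not_zero_iff by blast
  have "card (UNIV :: bit set) = 2"
    unfolding bit by simp
  then have "card (UNIV :: Q set) = 8"
    unfolding UNIV_Times_UNIV[symmetric] card_cartesian_product by simp
  then show ?thesis
    by (simp add: Gk_def card_cartesian_product)
qed

lemma l_connected_Gk:
  assumes "k > 0"
  shows "l_connected (2 * k + 2) (with_proj (Gk k))"
  unfolding l_connected_def with_proj_simps card_verts_Gk
proof (intro conjI allI impI)
  show "2 * k + 2 < 24 * k"
    using assms by simp
next
  fix S assume S: "S \<subseteq> pverts (Gk k) \<and> card S < 2 * k + 2"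
  have fin: "finite (pverts (Gk k))"
    by (rule card_ge_0_finite) (simp add: card_verts_Gk assms)
  show "Digraph_Component.connected (with_proj (Gk k) \<restriction> (pverts (Gk k) - S))"
    unfolding connected_induced_iff_colouring
  proof (intro conjI allI impI)
    have "card S < card (pverts (Gk k))"
      using S assms by (simp add: card_verts_Gk)
    then show "pverts (Gk k) - S \<noteq> {}"
      using S by auto
  next
    fix c :: "Q \<times> nat \<times> nat \<Rightarrow> bool"
    assume c: "\<forall>u\<in>pverts (Gk k) - S. \<forall>v\<in>pverts (Gk k) - S. (u, v) \<in> parcs (Gk k) \<longrightarrow> c u = c v"
    interpret pair_graph "Gk k"
      by (rule pair_graph_Gk)
    interpret colouring_off k S c
    proof
      show "c u = c v" if "(u, v) \<in> parcs (Gk k)" "u \<notin> S" "v \<notin> S" for u v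
        using c[THEN bspec, of u, THEN bspec, of v] that in_arcsD1[OF that(1)] in_arcsD2[OF that(1)]
        by simp
      show "finite S"
        using S finite_subset[OF _ fin] by simp
      show "card S \<le> 2 * k + 1"
        using S by simp
    qed (rule assms)
    obtain t where t: "\<And>x i r. i \<in> {0, 1, 2} \<Longrightarrow> alive x i r \<Longrightarrow> c (x, i, r) = t"
      using colouring_constant by metis
    have "c u = t" if "u \<in> pverts (Gk k) - S" for u
      using that t by (cases u) (auto simp: Gk_def alive_def)
    then show "\<forall>u\<in>pverts (Gk k) - S. \<forall>v\<in>pverts (Gk k) - S. c u = c v"
      by simp
  qed
qed

text \<open>The neighbourhood of \<open>000\<^sub>0\<close> has \<open>2 * k + 2\<close> elements and separates it from \<open>111\<^sub>0\<close>.\<close>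

lemma l_connected_Gk_le:
  assumes "k > 0" "l_connected l (with_proj (Gk k))"
  shows "l \<le> 2 * k + 2"
proof (rule ccontr)
  assume "\<not> l \<le> 2 * k + 2"
  define u :: "Q \<times> nat \<times> nat" where "u = (0, 0, 1)"
  define w :: "Q \<times> nat \<times> nat" where "w = ((1, 1, 1), 0, 1)"
  define S :: "(Q \<times> nat \<times> nat) set" where "S = {0} \<times> {1, 2} \<times> {1} \<union> P 0 \<times> {0} \<times> {1..k}"
  let ?U = "pverts (Gk k) - S"
  have "card S \<le> card ({0 :: Q} \<times> {1, 2 :: nat} \<times> {1 :: nat}) + card (P 0 \<times> {0 :: nat} \<times> {1..k})"
    unfolding S_def by (rule card_Un_le)
  also have "\<dots> = 2 * k + 2"
    by (simp add: card_cartesian_product P_def)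
  finally have "card S < l"
    using \<open>\<not> l \<le> 2 * k + 2\<close> by simp
  moreover have "S \<subseteq> pverts (Gk k)"
    using assms(1) by (auto simp: S_def Gk_def)
  ultimately have "Digraph_Component.connected (with_proj (Gk k) \<restriction> ?U)"
    using assms(2) by (simp add: l_connected_def)
  then have isolated: "(\<forall>x\<in>?U. \<forall>y\<in>?U. (x, y) \<in> parcs (Gk k) \<longrightarrow> (u = x) = (u = y)) \<longrightarrow>
      (\<forall>x\<in>?U. \<forall>y\<in>?U. (u = x) = (u = y))"
    unfolding connected_induced_iff_colouring by (rule conjunct2[THEN spec])
  have "(u = x) = (u = y)" if "x \<in> ?U" "y \<in> ?U" "(x, y) \<in> parcs (Gk k)" for x y
  proof -
    interpret pair_graph "Gk k"
      by (rule pair_graph_Gk)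
    have nbr: "v \<in> S" if "(u, v) \<in> parcs (Gk k)" for v
    proof -
      obtain x i r where v: "v = (x, i, r)"
        by (metis prod_cases3)
      show ?thesis
        using that unfolding u_def v S_def arc_Gk_iff by auto
    qed
    have "(y, x) \<in> parcs (Gk k)"
      using that(3) arcs_symmetric by blast
    with nbr that show ?thesis
      by blast
  qed
  then have same: "\<forall>x\<in>?U. \<forall>y\<in>?U. (u = x) = (u = y)"
    by (intro isolated[THEN mp] ballI impI)
  have uw: "u \<in> ?U" "w \<in> ?U" "u \<noteq> w"
    using assms(1) by (auto simp: u_def w_def S_def Gk_def P_def zero_prod_def)
  show False
    using same[THEN bspec, OF uw(1), THEN bspec, OF uw(2)] uw(3) by simp
qed

theorem proposition1:
  fixes k :: nat
  assumes "k > 0"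
  shows "connectivity (with_proj (Gk k)) = 2 * k + 2"
  unfolding connectivity_def
proof (rule Max_eqI)
  show "finite {l. l_connected l (with_proj (Gk k))}"
    by (rule finite_l_connected)
  show "l \<le> 2 * k + 2" if "l \<in> {l. l_connected l (with_proj (Gk k))}" for l
    using that by (intro l_connected_Gk_le[OF assms]) (rule CollectD)
  show "2 * k + 2 \<in> {l. l_connected l (with_proj (Gk k))}"
    by (rule CollectI) (rule l_connected_Gk[OF assms])
qed

end
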